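(* Let $E$ be a finite ground set with $|E|=n$, $f\colon 2^E\to\mathbb{R}_+$ a non-negative monotone submodular function (given by a value oracle), and $\mathcal{P}\subseteq[0,1]^E$ a polytope given by a separation oracle. Let $\varepsilon,\delta\in(0,1]$ and $V\in\mathbb{R}_+$, and run the Approximate-or-Separate algorithm described in the context with a cutting plane method $ALG$ that needs at most $T$ separation queries on $\mathcal{K}(V)$. Then whenever the algorithm outputs a vector $\vec{x}$, we always have $\vec{x}\in\mathcal{P}$, and with probability at least $1-\delta$ we have $F(\vec{x})\ge F(\vec{1}-\exp(-\vec{x}))\ge(1-1/e-\varepsilon)\cdot V$. Moreover, if $V\le\max_{\vec{x}\in\mathcal{P}} f^*(\vec{x})$, then the algorithm always outputs a vector $\vec{x}$. The algorithm makes $O\big(\tfrac{nT}{\varepsilon^2}\log(\delta^{-1}T)\big)$ value oracle queries to $f$ and at most $T$ separation oracle queries to $\mathcal{P}$.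
   Context: Notation: $f(i\mid S)\triangleq f(S\cup\{i\})-f(S)$. Multilinear extension: $F(\vec{x})=\sum_{S\subseteq E}f(S)\prod_{i\in S}x_i\prod_{i\notin S}(1-x_i)$. Coverage (Wolsey) extension: $f^*(\vec{x})=\min_{S\subseteq E}\big(f(S)+\sum_{i\in E}f(i\mid S)x_i\big)$. $\vec{1}-\exp(-\vec{x})$ is the vector with coordinates $1-\exp(-x_i)$. Let $\mathcal{K}(V)\triangleq\mathcal{P}\cap\{\vec{x}\mid f^*(\vec{x})\ge V\}$. A cutting plane method $ALG$ for $\mathcal{K}(V)$ with bound $T$ is a procedure that repeatedly queries points $\vec{x}$; whenever it is supplied, for each queried $\vec{x}\notin\mathcal{K}(V)$, a linear inequality valid for $\mathcal{K}(V)$ and violated by $\vec{x}$, then after at most $T$ queries it either correctly reports $\mathcal{K}(V)=\emptyset$ or finds a point of $\mathcal{K}(V)$. The Approximate-or-Separate algorithm on input $(f,\mathcal{P},\varepsilon,\delta,V)$: for up to $T$ steps of $ALG$, when $ALG$ queries $\vec{x}\in[0,1]^E$: if $\vec{x}\notin\mathcal{P}$, give $ALG$ a hyperplane separating $\vec{x}$ from $\mathcal{P}$ (via the separation oracle); otherwise, repeat $O(\varepsilon^{-2}\log(T\delta^{-1}))$ times: sample $S\triangleq\{i\in E\mid Y_i\le t\}$ for independent $t\sim\mathrm{Uni}[0,1]$ and $Y_i\sim\mathrm{Exp}(x_i)$ (exponential with rate $x_i$), and if $f(S)+\sum_{i\in E}f(i\mid S)x_i<(1-\varepsilon)V$, give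 $ALG$ the separating inequality $f(S)+\sum_{i\in E}f(i\mid S)y_i\ge V$ (in the variable $\vec{y}$). If in this step no separating hyperplane was found, return $\vec{x}$. If all $T$ steps finish without returning, return "$\mathcal{K}(V)=\emptyset$". *)

theory Defs
  imports "HOL-Probability.Probability"
begin

section \<open>Set functions and their extensions\<close>

definition submodular :: "('e set \<Rightarrow> real) \<Rightarrow> bool" where
  "submodular f \<longleftrightarrow> (\<forall>A B. f (A \<union> B) + f (A \<inter> B) \<le> f A + f B)"

definition marginal :: "('e set \<Rightarrow> real) \<Rightarrow> 'e \<Rightarrow> 'e set \<Rightarrow> real" where
  "marginal f i S = f (S \<union> {i}) - f S"

definition multilinear :: "('e::finite set \<Rightarrow> real) \<Rightarrow> real ^ 'e \<Rightarrow> real" where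
  "multilinear f x = (\<Sum>S\<in>UNIV. f S * (\<Prod>i\<in>S. x $ i) * (\<Prod>i\<in>-S. 1 - x $ i))"

definition coverage_ext :: "('e::finite set \<Rightarrow> real) \<Rightarrow> real ^ 'e \<Rightarrow> real" where
  "coverage_ext f x = Min (range (\<lambda>S. f S + (\<Sum>i\<in>UNIV. marginal f i S * x $ i)))"

definition feasible_region ::
  "('e::finite set \<Rightarrow> real) \<Rightarrow> (real ^ 'e) set \<Rightarrow> real \<Rightarrow> (real ^ 'e) set" where
  "feasible_region f P V = P \<inter> {x. coverage_ext f x \<ge> V}"


section \<open>Cuts, separation oracles and cutting plane methods\<close>

text \<open>The pair \<open>(a, b)\<close> stands for the linear inequality \<open>b \<le> a \<bullet> y\<close> in the variable \<open>y\<close>.\<close>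

type_synonym 'e cut = "(real ^ 'e) \<times> real"

definition separates :: "(real ^ 'e::finite) set \<Rightarrow> real ^ 'e \<Rightarrow> 'e cut \<Rightarrow> bool" where
  "separates K x c \<longleftrightarrow> (\<forall>y\<in>K. snd c \<le> fst c \<bullet> y) \<and> fst c \<bullet> x < snd c"

text \<open>The answer \<open>None\<close> means that the queried point belongs to \<open>P\<close>.\<close>

definition separation_oracle ::
  "(real ^ 'e::finite) set \<Rightarrow> (real ^ 'e \<Rightarrow> 'e cut option) \<Rightarrow> bool" where
  "separation_oracle P sep \<longleftrightarrow>
     (\<forall>x. case sep x of None \<Rightarrow> x \<in> P | Some c \<Rightarrow> separates P x c)"

text \<open>A cutting plane procedure maps the list of cuts received so far (oldest first) to its next
  query point, or to \<open>None\<close> if it reports that the target set is empty.\<close>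

type_synonym 'e cp_procedure = "'e cut list \<Rightarrow> (real ^ 'e) option"

text \<open>The lists of cuts that can arise when each query so far missed \<open>K\<close> and was answered by an
  inequality valid for \<open>K\<close> and violated by the query.\<close>

inductive proper_history :: "'e::finite cp_procedure \<Rightarrow> (real ^ 'e) set \<Rightarrow> 'e cut list \<Rightarrow> bool"
  for ALG K where
  "proper_history ALG K []"
| "proper_history ALG K h \<Longrightarrow> ALG h = Some x \<Longrightarrow> x \<notin> K \<Longrightarrow> separates K x c \<Longrightarrow>
     proper_history ALG K (h @ [c])"

text \<open>After \<open>h\<close>, exactly \<open>length h\<close> queries have been made and all of them missed \<open>K\<close>. Then an
  emptiness report has to be correct, and a further query may be made only if fewer than \<open>T\<close> were
  made before. Hence every such interaction ends after at most \<open>T\<close> queries, either with a correct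
  report or with a query that lies in \<open>K\<close>.\<close>

definition cutting_plane_method ::
  "'e::finite cp_procedure \<Rightarrow> (real ^ 'e) set \<Rightarrow> nat \<Rightarrow> bool" where
  "cutting_plane_method ALG K T \<longleftrightarrow>
     (\<forall>h. proper_history ALG K h \<longrightarrow>
        (case ALG h of None \<Rightarrow> K = {} | Some x \<Rightarrow> length h < T))"


section \<open>The random set\<close>

text \<open>The exponential distribution with rate \<open>r\<close>; for rate \<open>0\<close> it is the point mass at
  \<open>\<infinity>\<close>.\<close>

definition exp_law :: "real \<Rightarrow> ereal measure" where
  "exp_law r = (if r > 0 then distr (density lborel (\<lambda>y. ennreal (exponential_density r y))) borel ereal
                else return borel \<infinity>)"

definition sample_law :: "real ^ 'e::finite \<Rightarrow> 'e set measure" where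
  "sample_law x =
     distr (uniform_measure lborel {0..1} \<Otimes>\<^sub>M (\<Pi>\<^sub>M i\<in>UNIV. exp_law (x $ i))) (count_space UNIV)
       (\<lambda>(t, Y). {i. Y i \<le> ereal t})"

definition sample_pmf :: "real ^ 'e::finite \<Rightarrow> 'e set pmf" where
  "sample_pmf x = Abs_pmf (sample_law x)"

lemma sets_exp_law [measurable_cong, simp]: "sets (exp_law r) = sets borel"
  by (simp add: exp_law_def)

lemma space_exp_law [simp]: "space (exp_law r) = UNIV"
  by (simp add: exp_law_def)

lemma prob_space_exp_law: "prob_space (exp_law r)"
proof (cases "r > 0")
  case True
  interpret D: prob_space "density lborel (\<lambda>y. ennreal (exponential_density r y))"
    using True by (rule prob_space_exponential_density)
  show ?thesis
    using True by (auto simp: exp_law_def intro!: D.prob_space_distr)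
next
  case False
  then show ?thesis
    by (auto simp: exp_law_def intro!: prob_space_return)
qed

lemma sample_set_measurable:
  "(\<lambda>(t, Y). {i. Y i \<le> ereal t})
     \<in> (uniform_measure lborel {0..1} \<Otimes>\<^sub>M (\<Pi>\<^sub>M i\<in>UNIV. exp_law (x $ i)))
        \<rightarrow>\<^sub>M count_space (UNIV :: 'e::finite set set)"
    (is "?g \<in> ?M \<rightarrow>\<^sub>M _")
proof (rule measurable_count_space_eq_countable[THEN iffD2])
  show "countable (UNIV :: 'e set set)"
    by (simp add: countable_finite)
  show "?g \<in> space ?M \<rightarrow> UNIV \<and> (\<forall>S\<in>UNIV. ?g -` {S} \<inter> space ?M \<in> sets ?M)"
  proof (intro conjI ballI)
    fix S :: "'e set"
    have [measurable]: "(\<lambda>p. snd p i) \<in> borel_measurable ?M" for i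
      by measurable
    have [measurable]: "(\<lambda>p. ereal (fst p)) \<in> borel_measurable ?M"
      by measurable
    have "?g -` {S} \<inter> space ?M = {p \<in> space ?M. (\<forall>i\<in>S. snd p i \<le> ereal (fst p)) \<and>
        (\<forall>i\<in>-S. \<not> snd p i \<le> ereal (fst p))}"
      by auto
    also have "\<dots> \<in> sets ?M"
      by measurable
    finally show "?g -` {S} \<inter> space ?M \<in> sets ?M" .
  qed auto
qed

lemma measure_pmf_sample_pmf: "measure_pmf (sample_pmf x) = sample_law x"
proof -
  interpret U: prob_space "uniform_measure lborel {0..1::real}"
    by (rule prob_space_uniform_measure) auto
  interpret Y: prob_space "\<Pi>\<^sub>M i\<in>UNIV. exp_law (x $ i)"
    by (intro prob_space_PiM prob_space_exp_law)
  interpret UY: pair_prob_space "uniform_measure lborel {0..1::real}" "\<Pi>\<^sub>M i\<in>UNIV. exp_law (x $ i)"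
    by unfold_locales
  have p: "prob_space (sample_law x)"
    unfolding sample_law_def by (rule UY.prob_space_distr[OF sample_set_measurable])
  interpret L: prob_space "sample_law x" by (rule p)
  have s: "sets (sample_law x) = UNIV" by (simp add: sample_law_def)
  have "AE S in sample_law x. measure (sample_law x) {S} \<noteq> 0"
    by (subst L.AE_support_countable) (auto simp: s intro!: exI[of _ UNIV] countable_finite)
  then show ?thesis
    using p s by (simp add: sample_pmf_def Abs_pmf_inverse)
qed


section \<open>Randomized oracle programs\<close>

text \<open>Programs reach the set function and the polytope only through oracle queries.
  \<open>Sample x\<close> draws a random set with law \<open>sample_law x\<close>.\<close>

datatype ('e::finite, 'a) prog =
    Return 'a
  | Value_Query "'e set" "real \<Rightarrow> ('e, 'a) prog"
  | Separation_Query "real ^ 'e" "'e cut option \<Rightarrow> ('e, 'a) prog"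
  | Sample "real ^ 'e" "'e set \<Rightarrow> ('e, 'a) prog"

text \<open>The joint law of the result, the number of value queries and the number of separation
  queries.\<close>

primrec run ::
  "('e::finite set \<Rightarrow> real) \<Rightarrow> (real ^ 'e \<Rightarrow> 'e cut option) \<Rightarrow> ('e, 'a) prog \<Rightarrow> ('a \<times> nat \<times> nat) pmf"
where
  "run f sep (Return a) = return_pmf (a, 0, 0)"
| "run f sep (Value_Query S k) = map_pmf (\<lambda>(a, q, s). (a, Suc q, s)) (run f sep (k (f S)))"
| "run f sep (Separation_Query x k) = map_pmf (\<lambda>(a, q, s). (a, q, Suc s)) (run f sep (k (sep x)))"
| "run f sep (Sample x k) = bind_pmf (sample_pmf x) (\<lambda>S. run f sep (k S))"


section \<open>The Approximate-or-Separate algorithm\<close>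

definition ground_list :: "'e::finite list" where
  "ground_list = (SOME es. distinct es \<and> set es = UNIV)"

text \<open>Passes to the continuation \<open>k\<close> a function whose value at each \<open>i\<close> in the list is the answer to
  the query \<open>S \<union> {i}\<close>.\<close>

primrec query_extensions ::
  "'e::finite set \<Rightarrow> 'e list \<Rightarrow> (('e \<Rightarrow> real) \<Rightarrow> ('e, 'a) prog) \<Rightarrow> ('e, 'a) prog" where
  "query_extensions S [] k = k (\<lambda>_. 0)"
| "query_extensions S (i # is) k =
     Value_Query (S \<union> {i}) (\<lambda>v. query_extensions S is (\<lambda>g. k (g(i := v))))"

text \<open>At most \<open>m\<close> rounds of sampling at \<open>x\<close>. With \<open>v = f S\<close> and \<open>a $ i = f (S \<union> {i}) - f S\<close>, the
  inequality \<open>v + a \<bullet> y \<ge> V\<close> is the cut \<open>(a, V - v)\<close>; the first one found is passed to \<open>on_cut\<close>.\<close>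

primrec sample_cut ::
  "real \<Rightarrow> real \<Rightarrow> real ^ 'e::finite \<Rightarrow> ('e cut \<Rightarrow> ('e, 'a) prog) \<Rightarrow> ('e, 'a) prog \<Rightarrow> nat \<Rightarrow> ('e, 'a) prog"
where
  "sample_cut \<epsilon> V x on_cut no_cut 0 = no_cut"
| "sample_cut \<epsilon> V x on_cut no_cut (Suc m) =
     Sample x (\<lambda>S. Value_Query S (\<lambda>v. query_extensions S ground_list (\<lambda>g.
       let a = (\<chi> i. g i - v)
       in if v + a \<bullet> x < (1 - \<epsilon>) * V then on_cut (a, V - v)
          else sample_cut \<epsilon> V x on_cut no_cut m)))"

text \<open>Here \<open>m\<close> is the number of sampling repetitions per step, \<open>h\<close> the list of cuts given to \<open>ALG\<close>
  so far, and the last argument the number of remaining steps. The result \<open>None\<close> is the answer that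
  the feasible region is empty.\<close>

primrec approx_or_separate_steps ::
  "'e::finite cp_procedure \<Rightarrow> nat \<Rightarrow> real \<Rightarrow> real \<Rightarrow> 'e cut list \<Rightarrow> nat \<Rightarrow> ('e, (real ^ 'e) option) prog"
where
  "approx_or_separate_steps ALG m \<epsilon> V h 0 = Return None"
| "approx_or_separate_steps ALG m \<epsilon> V h (Suc k) =
     (case ALG h of
        None \<Rightarrow> Return None
      | Some x \<Rightarrow> Separation_Query x (\<lambda>r.
          case r of
            Some c \<Rightarrow> approx_or_separate_steps ALG m \<epsilon> V (h @ [c]) k
          | None \<Rightarrow> sample_cut \<epsilon> V x (\<lambda>c. approx_or_separate_steps ALG m \<epsilon> V (h @ [c]) k)
                     (Return (Some x)) m))"

definition approx_or_separate ::
  "'e::finite cp_procedure \<Rightarrow> nat \<Rightarrow> nat \<Rightarrow> real \<Rightarrow> real \<Rightarrow> ('e, (real ^ 'e) option) prog" where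
  "approx_or_separate ALG T m \<epsilon> V = approx_or_separate_steps ALG m \<epsilon> V [] T"

end

theory Submission
  imports Defs
begin

text \<open>Let \<open>S\<^sub>t\<close> contain each \<open>i\<close> independently with probability \<open>1 - exp (- t x\<^sub>i)\<close>, so that the
  sampled set is \<open>S\<^sub>t\<close> for uniform \<open>t\<close>. The function \<open>\<phi> t = F (1 - exp (- t x)) = E [f S\<^sub>t]\<close> satisfies
  \<open>\<phi> t + \<phi>' t = E [g S\<^sub>t]\<close>, where \<open>g S = f S + (\<Sum>i. f (i | S) x\<^sub>i)\<close>. Integrating the derivative
  \<open>exp t * E [g S\<^sub>t]\<close> of \<open>exp t * \<phi> t\<close> over \<open>[0, 1]\<close> gives \<open>\<phi> 1 \<ge> (1 - 1/e - p) W\<close>, where \<open>p\<close> is the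
  probability that the sampled set has \<open>g S < W\<close>. With \<open>W = (1 - \<epsilon>) V\<close>, a point \<open>x\<close> whose value
  \<open>\<phi> 1\<close> is below \<open>(1 - 1/e - \<epsilon>) V\<close> must have \<open>p > \<epsilon>/e \<ge> \<epsilon>\<^sup>2/3\<close>, hence survives all \<open>m\<close> samples with
  probability at most \<open>\<delta>/T\<close>; a union bound over the \<open>T\<close> steps finishes the probability estimate.
  Every cut that is found is valid for the feasible region, so when that region is nonempty the
  cutting plane method can neither report emptiness nor exhaust its \<open>T\<close> queries.\<close>

section \<open>The multilinear extension\<close>

text \<open>The law of a random set with independent memberships of probability \<open>y i\<close>.
  Keeping \<open>S\<close> inside the factors of one product over \<open>UNIV\<close> allows the
  product rule over a fixed index set.\<close>

definition product_weight :: "('e::finite \<Rightarrow> real) \<Rightarrow> 'e set \<Rightarrow> real" where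
  "product_weight y S = (\<Prod>i\<in>UNIV. if i \<in> S then y i else 1 - y i)"

lemma multilinear_eq_sum_product_weight:
  "multilinear f x = (\<Sum>S\<in>UNIV. f S * product_weight (($) x) S)"
  by (simp add: multilinear_def product_weight_def prod.If_cases Compl_eq mult.assoc)

lemma product_weight_nonneg:
  assumes "\<And>i. 0 \<le> y i" "\<And>i. y i \<le> 1"
  shows "0 \<le> product_weight y S"
  unfolding product_weight_def using assms by (intro prod_nonneg) auto

lemma sum_sets_split_element:
  fixes h :: "'e::finite set \<Rightarrow> real"
  shows "(\<Sum>S\<in>UNIV. h S) = (\<Sum>S | i \<notin> S. h S + h (insert i S))"
proof -
  have "(UNIV :: 'e set set) = {S. i \<notin> S} \<union> {S. i \<in> S}" by auto
  then have "(\<Sum>S\<in>UNIV. h S) = (\<Sum>S | i \<notin> S. h S) + (\<Sum>S | i \<in> S. h S)"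
    by (metis (no_types, lifting) finite sum.union_disjoint disjoint_iff mem_Collect_eq)
  moreover have "(\<Sum>S | i \<in> S. h S) = (\<Sum>S | i \<notin> S. h (insert i S))"
    by (rule sum.reindex_bij_witness[of _ "insert i" "\<lambda>S. S - {i}"]) (auto simp: insert_absorb)
  ultimately show ?thesis by (simp add: sum.distrib)
qed

lemma sum_product_weight: "(\<Sum>S\<in>UNIV. product_weight y S) = 1"
proof -
  have "(\<Sum>S\<in>UNIV. product_weight y S) = (\<Sum>S\<in>UNIV. (\<Prod>i\<in>S. y i) * (\<Prod>i\<in>UNIV - S. 1 - y i))"
    by (simp add: product_weight_def prod.If_cases Compl_eq_Diff_UNIV)
  also have "\<dots> = (\<Prod>i\<in>UNIV. y i + (1 - y i))"
    using prod_add[of UNIV y "\<lambda>i. 1 - y i"] by simp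
  finally show ?thesis by simp
qed

text \<open>By the product rule, the terms for \<open>S\<close> and \<open>insert i S\<close> carry
  opposite signs and the same product over the other elements, so each pair contributes a marginal.
  The curve \<open>y\<close> is general because both a segment and the exponential path are
  differentiated.\<close>

lemma multilinear_has_real_derivative:
  fixes y :: "real \<Rightarrow> 'e::finite \<Rightarrow> real"
  assumes y: "\<And>i. ((\<lambda>t. y t i) has_real_derivative y' i) (at t)"
  shows "((\<lambda>t. multilinear f (\<chi> i. y t i)) has_real_derivative
           (\<Sum>i\<in>UNIV. y' i * (\<Sum>S | i \<notin> S. marginal f i S *
              (\<Prod>j\<in>UNIV - {i}. if j \<in> S then y t j else 1 - y t j)))) (at t)"
proof -
  let ?r = "\<lambda>i S. \<Prod>j\<in>UNIV - {i}. if j \<in> S then y t j else 1 - y t j"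
  let ?c' = "\<lambda>i S. if i \<in> S then y' i else - y' i"
  have c: "((\<lambda>t. if i \<in> S then y t i else 1 - y t i) has_real_derivative ?c' i S) (at t)" for i S
    using y[of i] by (auto intro!: derivative_eq_intros)
  have w: "((\<lambda>t. product_weight (y t) S) has_real_derivative (\<Sum>i\<in>UNIV. ?c' i S * ?r i S)) (at t)"
    for S
    unfolding product_weight_def by (rule has_field_derivative_prod) (rule c)
  have "((\<lambda>t. multilinear f (\<chi> i. y t i)) has_real_derivative
          (\<Sum>S\<in>UNIV. f S * (\<Sum>i\<in>UNIV. ?c' i S * ?r i S))) (at t)"
    unfolding multilinear_eq_sum_product_weight
    by (auto simp: vec_lambda_inverse intro!: DERIV_sum DERIV_cmult w)
  also have "(\<Sum>S\<in>UNIV. f S * (\<Sum>i\<in>UNIV. ?c' i S * ?r i S))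
      = (\<Sum>i\<in>UNIV. \<Sum>S\<in>UNIV. f S * ?c' i S * ?r i S)"
    by (simp only: sum_distrib_left mult.assoc) (rule sum.swap)
  also have "\<dots> = (\<Sum>i\<in>UNIV. y' i * (\<Sum>S | i \<notin> S. marginal f i S * ?r i S))"
  proof (rule sum.cong[OF refl])
    fix i :: 'e
    have r: "?r i (insert i S) = ?r i S" for S
      by (rule prod.cong) auto
    have "(\<Sum>S\<in>UNIV. f S * ?c' i S * ?r i S)
        = (\<Sum>S | i \<notin> S. f S * ?c' i S * ?r i S + f (insert i S) * ?c' i (insert i S) * ?r i (insert i S))"
      by (rule sum_sets_split_element)
    also have "\<dots> = (\<Sum>S | i \<notin> S. y' i * (marginal f i S * ?r i S))"
      unfolding r by (rule sum.cong) (auto simp: marginal_def algebra_simps)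
    finally show "(\<Sum>S\<in>UNIV. f S * ?c' i S * ?r i S) = y' i * (\<Sum>S | i \<notin> S. marginal f i S * ?r i S)"
      by (simp add: sum_distrib_left)
  qed
  finally show ?thesis .
qed

lemma marginal_nonneg: "mono f \<Longrightarrow> 0 \<le> marginal f i S"
  by (simp add: marginal_def mono_def subset_insertI)

text \<open>Move along the segment from \<open>x\<close> to \<open>y\<close>: it stays in the cube,
  where the derivative is a sum of products of nonnegative increments, marginals and
  weights.\<close>

lemma multilinear_mono:
  fixes x y :: "real ^ 'e::finite"
  assumes f: "mono f" and x: "\<And>i. 0 \<le> x $ i" and xy: "\<And>i. x $ i \<le> y $ i" and y: "\<And>i. y $ i \<le> 1"
  shows "multilinear f x \<le> multilinear f y"
proof -
  define z where "z t i = x $ i + t * (y $ i - x $ i)" for t i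
  have "multilinear f (\<chi> i. z 0 i) \<le> multilinear f (\<chi> i. z 1 i)"
  proof (rule DERIV_nonneg_imp_nondecreasing[where f = "\<lambda>t. multilinear f (\<chi> i. z t i)"])
    fix t :: real assume t: "0 \<le> t" "t \<le> 1"
    have z01: "0 \<le> z t i" "z t i \<le> 1" for i
    proof -
      show "0 \<le> z t i" using t x[of i] xy[of i] by (simp add: z_def)
      have "t * (y $ i - x $ i) \<le> 1 * (y $ i - x $ i)"
        using t xy[of i] by (intro mult_right_mono) auto
      then show "z t i \<le> 1" using y[of i] by (simp add: z_def)
    qed
    have "((\<lambda>t. multilinear f (\<chi> i. z t i)) has_real_derivative
           (\<Sum>i\<in>UNIV. (y $ i - x $ i) * (\<Sum>S | i \<notin> S. marginal f i S *
              (\<Prod>j\<in>UNIV - {i}. if j \<in> S then z t j else 1 - z t j)))) (at t)"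
      by (rule multilinear_has_real_derivative) (auto simp: z_def intro!: derivative_eq_intros)
    moreover have "0 \<le> (\<Sum>i\<in>UNIV. (y $ i - x $ i) * (\<Sum>S | i \<notin> S. marginal f i S *
              (\<Prod>j\<in>UNIV - {i}. if j \<in> S then z t j else 1 - z t j)))"
      using xy z01
      by (intro sum_nonneg mult_nonneg_nonneg marginal_nonneg f prod_nonneg) auto
    ultimately show "\<exists>d. ((\<lambda>t. multilinear f (\<chi> i. z t i)) has_real_derivative d) (at t) \<and> 0 \<le> d"
      by blast
  qed simp
  then show ?thesis by (simp add: z_def)
qed

text \<open>The affine function of \<open>x\<close> whose minimum over \<open>S\<close> is
  \<open>coverage_ext\<close>, and also the quantity that the algorithm tests for a sampled
  \<open>S\<close>.\<close>

definition wolsey_value :: "('e::finite set \<Rightarrow> real) \<Rightarrow> real ^ 'e \<Rightarrow> 'e set \<Rightarrow> real" where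
  "wolsey_value f x S = f S + (\<Sum>i\<in>UNIV. marginal f i S * x $ i)"

text \<open>The factor \<open>exp t\<close> is the integrating factor that turns
  \<open>\<phi> t + \<phi>' t\<close> into a single derivative.\<close>

lemma multilinear_exp_path_has_real_derivative:
  fixes x :: "real ^ 'e::finite"
  defines "w \<equiv> \<lambda>t. product_weight (\<lambda>i. 1 - exp (- (t * x $ i)))"
  shows "((\<lambda>t. exp t * multilinear f (\<chi> i. 1 - exp (- (t * x $ i)))) has_real_derivative
           exp t * (\<Sum>S\<in>UNIV. wolsey_value f x S * w t S)) (at t)"
proof -
  let ?y = "\<lambda>t i. 1 - exp (- (t * x $ i))"
  let ?r = "\<lambda>i S. \<Prod>j\<in>UNIV - {i}. if j \<in> S then ?y t j else 1 - ?y t j"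
  let ?F = "\<lambda>t. multilinear f (\<chi> i. ?y t i)"
  have "(?F has_real_derivative
          (\<Sum>i\<in>UNIV. (x $ i * exp (- (t * x $ i))) * (\<Sum>S | i \<notin> S. marginal f i S * ?r i S))) (at t)"
    by (rule multilinear_has_real_derivative) (auto intro!: derivative_eq_intros)
  also have "(\<Sum>i\<in>UNIV. (x $ i * exp (- (t * x $ i))) * (\<Sum>S | i \<notin> S. marginal f i S * ?r i S))
      = (\<Sum>i\<in>UNIV. \<Sum>S\<in>UNIV. marginal f i S * x $ i * w t S)"
  proof (rule sum.cong[OF refl])
    fix i :: 'e
    \<comment> \<open>The derivative of coordinate \<open>i\<close> contains the factor
      \<open>1 - ?y t i\<close>, which is exactly what the reduced product lacks for a set avoiding
      \<open>i\<close>.\<close>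
    have "w t S = exp (- (t * x $ i)) * ?r i S" if "i \<notin> S" for S
      using that by (simp add: w_def product_weight_def prod.remove[of UNIV i])
    then have "(x $ i * exp (- (t * x $ i))) * (\<Sum>S | i \<notin> S. marginal f i S * ?r i S)
        = (\<Sum>S | i \<notin> S. marginal f i S * x $ i * w t S)"
      by (auto simp: sum_distrib_left algebra_simps intro!: sum.cong)
    \<comment> \<open>Sets that contain \<open>i\<close> have marginal zero, so they may be
      included.\<close>
    also have "\<dots> = (\<Sum>S\<in>UNIV. marginal f i S * x $ i * w t S)"
      by (rule sum.mono_neutral_left) (auto simp: marginal_def insert_absorb)
    finally show "(x $ i * exp (- (t * x $ i))) * (\<Sum>S | i \<notin> S. marginal f i S * ?r i S)
        = (\<Sum>S\<in>UNIV. marginal f i S * x $ i * w t S)" .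
  qed
  also have "\<dots> = (\<Sum>S\<in>UNIV. (\<Sum>i\<in>UNIV. marginal f i S * x $ i) * w t S)"
    by (subst sum.swap) (simp add: sum_distrib_right)
  finally have D: "(?F has_real_derivative \<dots>) (at t)" .
  have F: "?F t = (\<Sum>S\<in>UNIV. f S * w t S)"
    by (simp add: multilinear_eq_sum_product_weight w_def vec_lambda_inverse)
  have "exp t * (\<Sum>S\<in>UNIV. (\<Sum>i\<in>UNIV. marginal f i S * x $ i) * w t S) + exp t * ?F t
      = exp t * (\<Sum>S\<in>UNIV. wolsey_value f x S * w t S)"
    unfolding F by (simp add: wolsey_value_def ring_distribs sum.distrib)
  then show ?thesis
    using DERIV_mult[OF DERIV_exp[of t] D] by (simp add: mult.commute add.commute)
qed


section \<open>The sampled set\<close>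

lemma emeasure_exp_law_atMost:
  assumes r: "0 \<le> r" and t: "0 \<le> t"
  shows "emeasure (exp_law r) {..ereal t} = ennreal (1 - exp (- (t * r)))"
proof (cases "r > 0")
  case True
  have v: "ereal -` {..ereal t} = {..t}" by auto
  have "emeasure (exp_law r) {..ereal t}
      = emeasure (density lborel (\<lambda>y. ennreal (exponential_density r y))) {..t}"
    using True by (simp add: exp_law_def emeasure_distr v)
  also have "\<dots> = ennreal (1 - exp (- (t * r)))"
    using True t by (subst emeasure_erlang_density) (auto simp: erlang_CDF_0 mult.commute)
  finally show ?thesis .
next
  \<comment> \<open>At rate 0 the point mass at infinity misses every finite ray, in agreement with
    \<open>1 - exp 0 = 0\<close>.\<close>
  case False
  then show ?thesis using r by (simp add: exp_law_def)
qed

lemma emeasure_exp_law_greaterThan: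
  assumes r: "0 \<le> r" and t: "0 \<le> t"
  shows "emeasure (exp_law r) {ereal t<..} = ennreal (exp (- (t * r)))"
proof -
  interpret prob_space "exp_law r" by (rule prob_space_exp_law)
  have "{ereal t<..} = space (exp_law r) - {..ereal t}" by auto
  then have "emeasure (exp_law r) {ereal t<..} = 1 - ennreal (1 - exp (- (t * r)))"
    using emeasure_compl[of "{..ereal t}" "exp_law r"] emeasure_exp_law_atMost[OF r t]
      emeasure_space_1
    by simp
  also have "\<dots> = ennreal (exp (- (t * r)))"
    using r t by (simp add: ennreal_minus flip: ennreal_1)
  finally show ?thesis .
qed

abbreviation exp_weight :: "real ^ 'e::finite \<Rightarrow> real \<Rightarrow> 'e set \<Rightarrow> real" where
  "exp_weight x t \<equiv> product_weight (\<lambda>i. 1 - exp (- (t * x $ i)))"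

lemma exp_weight_nonneg:
  assumes "\<And>i. 0 \<le> x $ i" "0 \<le> t"
  shows "0 \<le> exp_weight x t S"
  using assms by (intro product_weight_nonneg) auto

text \<open>Fubini: once \<open>t\<close> is fixed, the event is a box in the independent
  coordinates \<open>Y\<close>, and its measure is a product of exponential tail and distribution
  values.\<close>

lemma emeasure_sample_law_singleton:
  fixes x :: "real ^ 'e::finite"
  assumes x: "\<And>i. 0 \<le> x $ i"
  shows "emeasure (sample_law x) {S}
    = (\<integral>\<^sup>+t. ennreal (exp_weight x t S) * indicator {0..1} t \<partial>lborel)"
proof -
  let ?U = "uniform_measure lborel {0..1::real}"
  let ?Y = "\<Pi>\<^sub>M i\<in>UNIV. exp_law (x $ i)"
  let ?g = "\<lambda>(t, Y). {i. Y i \<le> ereal t}"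
  interpret E: product_sigma_finite "\<lambda>i. exp_law (x $ i)"
    by (intro product_sigma_finite.intro prob_space_imp_sigma_finite prob_space_exp_law)
  interpret Y: prob_space ?Y
    by (intro prob_space_PiM prob_space_exp_law)
  have sets: "?g -` {S} \<inter> space (?U \<Otimes>\<^sub>M ?Y) \<in> sets (?U \<Otimes>\<^sub>M ?Y)"
    by (rule measurable_sets[OF sample_set_measurable]) simp
  have section_measure: "emeasure ?Y (Pair t -` (?g -` {S} \<inter> space (?U \<Otimes>\<^sub>M ?Y))) = ennreal (exp_weight x t S)"
    if t: "0 \<le> t" for t
  proof -
    have "Pair t -` (?g -` {S} \<inter> space (?U \<Otimes>\<^sub>M ?Y))
        = (\<Pi>\<^sub>E i\<in>UNIV. if i \<in> S then {..ereal t} else {ereal t<..})"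
      by (auto simp: space_pair_measure space_PiM PiE_def Pi_def not_le extensional_def split: if_splits)
         (metis (full_types) atMost_iff greaterThan_iff not_le)+
    then have "emeasure ?Y (Pair t -` (?g -` {S} \<inter> space (?U \<Otimes>\<^sub>M ?Y)))
        = (\<Prod>i\<in>UNIV. emeasure (exp_law (x $ i)) (if i \<in> S then {..ereal t} else {ereal t<..}))"
      by (simp add: E.emeasure_PiM)
    \<comment> \<open>The tail \<open>exp (- (t * x $ i))\<close> is written as
      \<open>1 - (1 - ...)\<close> to match the factors of \<open>product_weight\<close>.\<close>
    also have "\<dots> = (\<Prod>i\<in>UNIV. ennreal (if i \<in> S then 1 - exp (- (t * x $ i)) else 1 - (1 - exp (- (t * x $ i)))))"
      using x t by (intro prod.cong) (auto simp: emeasure_exp_law_atMost emeasure_exp_law_greaterThan)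
    also have "\<dots> = ennreal (exp_weight x t S)"
      unfolding product_weight_def using x t by (intro prod_ennreal) auto
    finally show ?thesis .
  qed
  have "emeasure (sample_law x) {S} = emeasure (?U \<Otimes>\<^sub>M ?Y) (?g -` {S} \<inter> space (?U \<Otimes>\<^sub>M ?Y))"
    unfolding sample_law_def by (rule emeasure_distr[OF sample_set_measurable]) simp
  also have "\<dots> = (\<integral>\<^sup>+t. emeasure ?Y (Pair t -` (?g -` {S} \<inter> space (?U \<Otimes>\<^sub>M ?Y))) \<partial>?U)"
    by (rule Y.emeasure_pair_measure_alt[OF sets])
  also have "\<dots> = (\<integral>\<^sup>+t. emeasure ?Y (Pair t -` (?g -` {S} \<inter> space (?U \<Otimes>\<^sub>M ?Y))) * indicator {0..1} t \<partial>lborel)"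
    using Y.measurable_emeasure_Pair[OF sets]
    by (subst nn_integral_uniform_measure) (auto cong: measurable_cong_sets simp: divide_ennreal_def)
  also have "\<dots> = (\<integral>\<^sup>+t. ennreal (exp_weight x t S) * indicator {0..1} t \<partial>lborel)"
    by (intro nn_integral_cong) (auto simp: section_measure simp del: vimage_Int split: split_indicator)
  finally show ?thesis .
qed

text \<open>Restates the singleton probabilities with the integral for which the fundamental theorem
  of calculus is available.\<close>

lemma pmf_sample_has_integral:
  fixes x :: "real ^ 'e::finite"
  assumes x: "\<And>i. 0 \<le> x $ i"
  shows "((\<lambda>t. exp_weight x t S) has_integral pmf (sample_pmf x) S) {0..1}"
proof -
  have "continuous_on {0..1} (\<lambda>t. exp_weight x t S)"
    unfolding product_weight_def
  proof (rule continuous_on_prod)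
    fix i show "continuous_on {0..1} (\<lambda>t. if i \<in> S then 1 - exp (- (t * x $ i)) else 1 - (1 - exp (- (t * x $ i))))"
      by (cases "i \<in> S") (auto intro!: continuous_intros)
  qed
  then have I: "((\<lambda>t. exp_weight x t S) has_integral integral {0..1} (\<lambda>t. exp_weight x t S)) {0..1}"
    by (intro integrable_integral integrable_continuous_real)
  have nonneg: "0 \<le> exp_weight x t S" if "t \<in> {0..1}" for t
    using that x by (intro exp_weight_nonneg) auto
  have "ennreal (pmf (sample_pmf x) S) = emeasure (sample_law x) {S}"
    by (simp add: emeasure_pmf_single flip: measure_pmf_sample_pmf)
  also have "\<dots> = ennreal (integral {0..1} (\<lambda>t. exp_weight x t S))"
    using nn_integral_has_integral_lebesgue'[OF nonneg I] by (simp add: emeasure_sample_law_singleton x)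
  finally have "pmf (sample_pmf x) S = integral {0..1} (\<lambda>t. exp_weight x t S)"
    using has_integral_nonneg[OF I nonneg] by simp
  then show ?thesis using I by simp
qed

section \<open>From the integral identity to a lower bound on the violation probability\<close>

lemma multilinear_ge_of_few_violations:
  fixes x :: "real ^ 'e::finite"
  assumes f_nonneg: "\<And>S. 0 \<le> f S" and f_mono: "mono f" and x: "\<And>i. 0 \<le> x $ i"
    and W: "0 \<le> W"
  shows "(1 - 1 / exp 1 - measure_pmf.prob (sample_pmf x) {S. wolsey_value f x S < W}) * W
    \<le> multilinear f (\<chi> i. 1 - exp (- (x $ i)))"
proof -
  let ?B = "{S. wolsey_value f x S < W}"
  let ?p = "measure_pmf.prob (sample_pmf x) ?B"
  let ?G = "\<lambda>t. exp t * multilinear f (\<chi> i. 1 - exp (- (t * x $ i)))"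
  let ?G' = "\<lambda>t. exp t * (\<Sum>S\<in>UNIV. wolsey_value f x S * exp_weight x t S)"
  let ?q = "\<lambda>t. \<Sum>S\<in>?B. exp_weight x t S"
  have G: "(?G' has_integral (?G 1 - ?G 0)) {0..1}"
    by (rule fundamental_theorem_of_calculus)
       (auto simp flip: has_real_derivative_iff_has_vector_derivative
         intro: has_field_derivative_at_within multilinear_exp_path_has_real_derivative)
  have "(?q has_integral (\<Sum>S\<in>?B. pmf (sample_pmf x) S)) {0..1}"
    by (intro has_integral_sum pmf_sample_has_integral x) simp
  then have q: "(?q has_integral ?p) {0..1}"
    by (simp add: measure_measure_pmf_finite)
  have "(exp has_integral (exp 1 - exp (0::real))) {0..1}"
    by (rule fundamental_theorem_of_calculus)
       (auto simp flip: has_real_derivative_iff_has_vector_derivative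
         intro: has_field_derivative_at_within DERIV_exp)
  then have e: "(exp has_integral (exp 1 - 1 :: real)) {0..1}" by simp
  \<comment> \<open>This integrand is the lower bound for \<open>?G'\<close>: value \<open>W\<close>
    on all sets, minus a correction for the violating mass \<open>?q t\<close>.\<close>
  have L: "((\<lambda>t. W * exp t - exp 1 * W * ?q t) has_integral (W * (exp 1 - 1) - exp 1 * W * ?p)) {0..1}"
    by (intro has_integral_diff has_integral_mult_right e q)
  have wolsey_nonneg: "0 \<le> wolsey_value f x S" for S
    unfolding wolsey_value_def using x f_nonneg
    by (intro add_nonneg_nonneg sum_nonneg mult_nonneg_nonneg marginal_nonneg f_mono) auto
  have "W * (exp 1 - 1) - exp 1 * W * ?p \<le> ?G 1 - ?G 0"
  proof (rule has_integral_le[OF L G])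
    fix t :: real assume t: "t \<in> {0..1}"
    have w: "0 \<le> exp_weight x t S" for S using t x by (intro exp_weight_nonneg) auto
    have q0: "0 \<le> ?q t" by (intro sum_nonneg w)
    have "W * (1 - ?q t) = (\<Sum>S\<in>-?B. W * exp_weight x t S)"
    proof -
      have "(\<Sum>S\<in>UNIV. exp_weight x t S) = ?q t + (\<Sum>S\<in>-?B. exp_weight x t S)"
        by (subst sum.union_disjoint[symmetric]) auto
      then have "1 - ?q t = (\<Sum>S\<in>-?B. exp_weight x t S)" by (simp add: sum_product_weight)
      then show ?thesis by (simp add: sum_distrib_left)
    qed
    \<comment> \<open>Non-violating sets have value at least \<open>W\<close>; violating ones are
      then added back with values that are merely nonnegative.\<close>
    also have "\<dots> \<le> (\<Sum>S\<in>-?B. wolsey_value f x S * exp_weight x t S)"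
      by (intro sum_mono mult_right_mono w) auto
    also have "\<dots> \<le> (\<Sum>S\<in>UNIV. wolsey_value f x S * exp_weight x t S)"
      by (intro sum_mono2 mult_nonneg_nonneg w wolsey_nonneg) auto
    finally have "exp t * (W * (1 - ?q t)) \<le> ?G' t"
      by (intro mult_left_mono) auto
    \<comment> \<open>Replacing \<open>exp t\<close> by \<open>exp 1\<close> on the violating mass
      makes the correction a constant multiple of \<open>?q t\<close>, whose integral is
      \<open>?p\<close>.\<close>
    moreover have "exp t * (W * ?q t) \<le> exp 1 * (W * ?q t)"
      using t q0 W by (intro mult_right_mono mult_nonneg_nonneg) auto
    ultimately show "W * exp t - exp 1 * W * ?q t \<le> ?G' t"
      by (simp add: algebra_simps)
  qed
  moreover have "0 \<le> ?G 0"
    unfolding multilinear_eq_sum_product_weight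
    by (intro mult_nonneg_nonneg sum_nonneg f_nonneg product_weight_nonneg) auto
  ultimately have "W * (exp 1 - 1) - exp 1 * W * ?p \<le> exp 1 * multilinear f (\<chi> i. 1 - exp (- (x $ i)))"
    by simp
  moreover have "e * ((1 - 1 / e - p) * W) = W * (e - 1) - e * W * p" if "e \<noteq> 0" for e p :: real
    using that by (simp add: field_simps)
  from this[of "exp 1"] have "exp 1 * ((1 - 1 / exp 1 - ?p) * W) = W * (exp 1 - 1) - exp 1 * W * ?p"
    by simp
  ultimately have "exp 1 * ((1 - 1 / exp 1 - ?p) * W) \<le> exp 1 * multilinear f (\<chi> i. 1 - exp (- (x $ i)))"
    by simp
  then show ?thesis by (rule mult_left_le_imp_le) simp
qed

text \<open>By contradiction: a smaller violation probability would lie below \<epsilon>/e, and then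
  the bound for \<open>W = (1 - \<epsilon>) * V\<close> would already reach the target
  value.\<close>

lemma violation_probability_lower_bound:
  fixes x :: "real ^ 'e::finite"
  assumes f_nonneg: "\<And>S. 0 \<le> f S" and f_mono: "mono f" and x: "\<And>i. 0 \<le> x $ i"
    and eps: "0 < \<epsilon>" "\<epsilon> \<le> 1" and V: "0 \<le> V"
    and bad: "multilinear f (\<chi> i. 1 - exp (- (x $ i))) < (1 - 1 / exp 1 - \<epsilon>) * V"
  shows "\<epsilon>\<^sup>2 / 3 \<le> measure_pmf.prob (sample_pmf x) {S. wolsey_value f x S < (1 - \<epsilon>) * V}"
    (is "_ \<le> ?p")
proof (rule ccontr)
  assume "\<not> ?thesis"
  then have p: "?p < \<epsilon>\<^sup>2 / 3" by simp
  have "\<epsilon>\<^sup>2 \<le> \<epsilon>" using eps by (simp add: power2_eq_square mult_left_le)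
  moreover have "\<epsilon> / 3 \<le> \<epsilon> / exp 1"
    using eps exp_le by (intro divide_left_mono) auto
  ultimately have p': "?p \<le> \<epsilon> / exp 1" using p by linarith
  have "(1 - \<epsilon>) * ?p \<le> 1 * ?p"
    using eps by (intro mult_right_mono) auto
  then have "(1 - \<epsilon>) * ?p \<le> \<epsilon> * (1 / exp 1)" using p' by simp
  \<comment> \<open>The right side expands to
    \<open>1 - c - \<epsilon> + (\<epsilon> * c - (1 - \<epsilon>) * p)\<close>; it is applied with
    \<open>c = 1 / exp 1\<close>.\<close>
  moreover have "1 - c - \<epsilon> \<le> (1 - c - p) * (1 - \<epsilon>)" if "(1 - \<epsilon>) * p \<le> \<epsilon> * c" for c p
    using that by (simp add: algebra_simps)
  ultimately have "1 - 1 / exp 1 - \<epsilon> \<le> (1 - 1 / exp 1 - ?p) * (1 - \<epsilon>)"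
    by blast
  then have "(1 - 1 / exp 1 - \<epsilon>) * V \<le> (1 - 1 / exp 1 - ?p) * (1 - \<epsilon>) * V"
    using V by (rule mult_right_mono)
  also have "\<dots> \<le> multilinear f (\<chi> i. 1 - exp (- (x $ i)))"
    using multilinear_ge_of_few_violations[OF f_nonneg f_mono x, of "(1 - \<epsilon>) * V"] eps V
    by (simp add: mult.assoc)
  finally show False using bad by simp
qed


section \<open>Runs of the algorithm\<close>

lemma distinct_ground_list: "distinct (ground_list :: 'e::finite list)"
  and set_ground_list: "set (ground_list :: 'e::finite list) = UNIV"
proof -
  have "\<exists>es :: 'e list. distinct es \<and> set es = UNIV"
    using finite_distinct_list[of "UNIV :: 'e set"] by auto
  from someI_ex[OF this] show "distinct (ground_list :: 'e list)" "set (ground_list :: 'e list) = UNIV"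
    unfolding ground_list_def by auto
qed

lemma length_ground_list: "length (ground_list :: 'e::finite list) = CARD('e)"
  using distinct_card[OF distinct_ground_list[where 'e = 'e]] by (simp add: set_ground_list)

text \<open>For fixed \<open>S\<close> the answers are deterministic, so the continuation runs once
  on the tabulated function and only the counter shifts. The value 0 off the list is the default of
  the empty case; it never occurs for \<open>ground_list\<close>.\<close>

lemma run_query_extensions:
  "run f sep (query_extensions S is k)
     = map_pmf (\<lambda>(a, q, s). (a, q + length is, s))
         (run f sep (k (\<lambda>i. if i \<in> set is then f (S \<union> {i}) else 0)))"
proof (induction "is" arbitrary: k)
  case Nil
  then show ?case by (simp add: case_prod_unfold)
next
  case (Cons j js)
  have "(\<lambda>i. if i \<in> set js then f (S \<union> {i}) else 0)(j := f (S \<union> {j}))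
      = (\<lambda>i. if i \<in> set (j # js) then f (S \<union> {i}) else 0)"
    by auto
  then show ?case
    by (simp add: Cons.IH pmf.map_comp o_def case_prod_unfold)
qed

text \<open>The pair that \<open>sample_cut\<close> builds from \<open>S\<close> once the oracle
  answers are substituted.\<close>

definition wolsey_cut :: "('e::finite set \<Rightarrow> real) \<Rightarrow> real \<Rightarrow> 'e set \<Rightarrow> 'e cut" where
  "wolsey_cut f V S = (\<chi> i. marginal f i S, V - f S)"

lemma wolsey_cut_inner: "f S + fst (wolsey_cut f V S) \<bullet> x = wolsey_value f x S"
  by (simp add: wolsey_cut_def wolsey_value_def inner_vec_def)

text \<open>A round costs one value query for \<open>S\<close> and one for each ground
  element.\<close>

lemma run_sample_cut_Suc:
  fixes x :: "real ^ 'e::finite"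
  shows "run f sep (sample_cut \<epsilon> V x on_cut no_cut (Suc m))
    = bind_pmf (sample_pmf x) (\<lambda>S. map_pmf (\<lambda>(a, q, s). (a, q + (CARD('e) + 1), s))
        (if wolsey_value f x S < (1 - \<epsilon>) * V then run f sep (on_cut (wolsey_cut f V S))
         else run f sep (sample_cut \<epsilon> V x on_cut no_cut m)))"
proof -
  have a: "(\<chi> i. f (insert i S) - f S) = fst (wolsey_cut f V S)" for S
    by (simp add: wolsey_cut_def marginal_def)
  have b: "(fst (wolsey_cut f V S), V - f S) = wolsey_cut f V S" for S
    by (simp add: wolsey_cut_def)
  show ?thesis
    by (simp add: run_query_extensions set_ground_list length_ground_list Let_def a b
        wolsey_cut_inner pmf.map_comp o_def case_prod_unfold if_distrib[of "run f sep"] cong: if_cong)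
qed

text \<open>Reduces every statement about possible outcomes to the two exits of the sampling loop.
  The query count is only bounded, since a cut may end the loop early; \<open>s\<close> is unchanged
  because sampling makes no separation queries.\<close>

lemma set_pmf_run_sample_cutE:
  fixes x :: "real ^ 'e::finite"
  assumes "(r, q, s) \<in> set_pmf (run f sep (sample_cut \<epsilon> V x on_cut no_cut m))"
  obtains (no_cut) q' where "q \<le> q' + m * (CARD('e) + 1)" "(r, q', s) \<in> set_pmf (run f sep no_cut)"
  | (cut) q' S where "q \<le> q' + m * (CARD('e) + 1)" "wolsey_value f x S < (1 - \<epsilon>) * V"
      "(r, q', s) \<in> set_pmf (run f sep (on_cut (wolsey_cut f V S)))"
proof -
  have "\<exists>q'. q \<le> q' + m * (CARD('e) + 1) \<and> ((r, q', s) \<in> set_pmf (run f sep no_cut) \<or>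
      (\<exists>S. wolsey_value f x S < (1 - \<epsilon>) * V \<and>
        (r, q', s) \<in> set_pmf (run f sep (on_cut (wolsey_cut f V S)))))"
    using assms
  proof (induction m arbitrary: q)
    case 0
    then show ?case by auto
  next
    case (Suc m)
    from Suc.prems obtain S q1 where q: "q = q1 + (CARD('e) + 1)"
      and q1: "(r, q1, s) \<in> set_pmf (if wolsey_value f x S < (1 - \<epsilon>) * V
          then run f sep (on_cut (wolsey_cut f V S))
          else run f sep (sample_cut \<epsilon> V x on_cut no_cut m))"
      unfolding run_sample_cut_Suc by (auto simp del: sample_cut.simps)
    show ?case
    proof (cases "wolsey_value f x S < (1 - \<epsilon>) * V")
      case True
      then show ?thesis using q q1 by (intro exI[of _ q1]) auto
    next
      case False
      with q1 have "(r, q1, s) \<in> set_pmf (run f sep (sample_cut \<epsilon> V x on_cut no_cut m))" by simp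
      from Suc.IH[OF this] obtain q' where q': "q1 \<le> q' + m * (CARD('e) + 1)"
          "(r, q', s) \<in> set_pmf (run f sep no_cut) \<or>
           (\<exists>S. wolsey_value f x S < (1 - \<epsilon>) * V \<and>
             (r, q', s) \<in> set_pmf (run f sep (on_cut (wolsey_cut f V S))))"
        by blast
      have "q \<le> q' + Suc m * (CARD('e) + 1)" using q q'(1) by simp
      with q'(2) show ?thesis by blast
    qed
  qed
  then show ?thesis using that by blast
qed

text \<open>A point is returned only after the oracle has confirmed membership in \<open>P\<close>,
  and each step spends one separation query and at most \<open>m\<close> sampling rounds.\<close>

lemma set_pmf_run_steps:
  fixes sep :: "real ^ 'e::finite \<Rightarrow> 'e cut option"
  assumes sep: "separation_oracle P sep"
    and "(r, q, s) \<in> set_pmf (run f sep (approx_or_separate_steps ALG m \<epsilon> V h k))"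
  shows "(\<forall>x. r = Some x \<longrightarrow> x \<in> P) \<and> q \<le> k * (m * (CARD('e) + 1)) \<and> s \<le> k"
  using assms(2)
proof (induction k arbitrary: h q s)
  case 0
  then show ?case by simp
next
  case (Suc k)
  show ?case
  proof (cases "ALG h")
    case None
    then show ?thesis using Suc.prems by simp
  next
    case (Some x)
    show ?thesis
    proof (cases "sep x")
      case None
      then have xP: "x \<in> P"
        using sep unfolding separation_oracle_def by (metis option.simps(4))
      from Suc.prems obtain s' where s: "s = Suc s'" and
        "(r, q, s') \<in> set_pmf (run f sep (sample_cut \<epsilon> V x
            (\<lambda>c. approx_or_separate_steps ALG m \<epsilon> V (h @ [c]) k) (Return (Some x)) m))"
        by (auto simp: \<open>ALG h = Some x\<close> None)
      from this(2) show ?thesis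
      proof (cases rule: set_pmf_run_sample_cutE)
        case (no_cut q')
        then show ?thesis using s xP by auto
      next
        case (cut q' S)
        then show ?thesis using s Suc.IH[OF cut(3)] by auto
      qed
    next
      case (Some c)
      with Suc.prems \<open>ALG h = Some x\<close> obtain s' where s: "s = Suc s'" and
        "(r, q, s') \<in> set_pmf (run f sep (approx_or_separate_steps ALG m \<epsilon> V (h @ [c]) k))"
        by auto
      from Suc.IH[OF this(2)] show ?thesis using s by auto
    qed
  qed
qed

section \<open>Valid cuts, and why a point is returned\<close>

lemma coverage_ext_le_wolsey_value: "coverage_ext f x \<le> wolsey_value f x S"
  unfolding coverage_ext_def wolsey_value_def by (rule Min_le) auto

text \<open>Validity: \<open>coverage_ext\<close> is a lower bound for \<open>wolsey_value\<close>
  at every set. Violation: the sampled value is below \<open>(1 - \<epsilon>) * V\<close>, which is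
  at most \<open>V\<close>.\<close>

lemma separates_wolsey_cut:
  assumes "wolsey_value f x S < (1 - \<epsilon>) * V" "0 \<le> \<epsilon>" "0 \<le> V"
  shows "separates (feasible_region f P V) x (wolsey_cut f V S)"
proof -
  have c: "snd (wolsey_cut f V S) = V - f S" by (simp add: wolsey_cut_def)
  have "(1 - \<epsilon>) * V \<le> V" using assms by (simp add: mult_le_cancel_right1 algebra_simps)
  then have "fst (wolsey_cut f V S) \<bullet> x < snd (wolsey_cut f V S)"
    using assms(1) wolsey_cut_inner[of f S V x] c by linarith
  moreover have "snd (wolsey_cut f V S) \<le> fst (wolsey_cut f V S) \<bullet> y"
    if "y \<in> feasible_region f P V" for y
    using that coverage_ext_le_wolsey_value[of f y S] wolsey_cut_inner[of f S V y] c
    by (auto simp: feasible_region_def)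
  ultimately show ?thesis by (auto simp: separates_def)
qed

lemma separates_imp_notin: "separates K x c \<Longrightarrow> x \<notin> K"
  by (auto simp: separates_def not_le)

text \<open>The invariant is a proper history with \<open>length h + k = T\<close>. Nonemptiness
  rules out \<open>ALG h = None\<close>, and at \<open>k = 0\<close> a further query is ruled out
  too, so the steps cannot run out.\<close>

lemma set_pmf_run_steps_Some:
  fixes sep :: "real ^ 'e::finite \<Rightarrow> 'e cut option"
  assumes sep: "separation_oracle P sep" and eps: "0 \<le> \<epsilon>" and V: "0 \<le> V"
    and ALG: "cutting_plane_method ALG (feasible_region f P V) T"
    and nonempty: "feasible_region f P V \<noteq> {}"
    and "proper_history ALG (feasible_region f P V) h" "length h + k = T"
    and "(r, q, s) \<in> set_pmf (run f sep (approx_or_separate_steps ALG m \<epsilon> V h k))"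
  shows "\<exists>x. r = Some x"
  using assms(6-8)
proof (induction k arbitrary: h q s)
  case 0
  then show ?case
    using ALG nonempty unfolding cutting_plane_method_def by (fastforce split: option.splits)
next
  case (Suc k)
  obtain x where x: "ALG h = Some x"
    using ALG nonempty Suc.prems(1) unfolding cutting_plane_method_def by (fastforce split: option.splits)
  have extend: "proper_history ALG (feasible_region f P V) (h @ [c])"
    if "separates (feasible_region f P V) x c" for c
    using Suc.prems(1) x separates_imp_notin[OF that] that by (rule proper_history.intros)
  show ?case
  proof (cases "sep x")
    case None
    from Suc.prems(3) obtain s' where
      "(r, q, s') \<in> set_pmf (run f sep (sample_cut \<epsilon> V x
          (\<lambda>c. approx_or_separate_steps ALG m \<epsilon> V (h @ [c]) k) (Return (Some x)) m))"
      by (auto simp: x None)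
    then show ?thesis
    proof (cases rule: set_pmf_run_sample_cutE)
      case (no_cut q')
      then show ?thesis by auto
    next
      case (cut q' S)
      from Suc.IH[OF extend[OF separates_wolsey_cut[OF cut(2) eps V]] _ cut(3)] Suc.prems(2)
      show ?thesis by simp
    qed
  next
    case (Some c)
    then have "separates P x c"
      using sep unfolding separation_oracle_def by (metis option.simps(5))
    \<comment> \<open>A cut valid for \<open>P\<close> is valid for its subset, the feasible
      region.\<close>
    then have c: "separates (feasible_region f P V) x c"
      by (auto simp: separates_def feasible_region_def)
    from Some Suc.prems(3) obtain s' where
      "(r, q, s') \<in> set_pmf (run f sep (approx_or_separate_steps ALG m \<epsilon> V (h @ [c]) k))"
      by (auto simp: x)
    from Suc.IH[OF extend[OF c] _ this] Suc.prems(2) show ?thesis by simp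
  qed
qed

lemma wolsey_value_continuous_on: "continuous_on A (\<lambda>x. wolsey_value f x S)"
  unfolding wolsey_value_def by (intro continuous_intros)

text \<open>A minimum of finitely many affine functions is continuous, so the supremum over the
  compact set \<open>P\<close> is attained, and a maximiser is feasible.\<close>

lemma feasible_region_nonempty:
  fixes P :: "(real ^ 'e::finite) set"
  assumes P: "compact P" "P \<noteq> {}" and V: "V \<le> (SUP x\<in>P. coverage_ext f x)"
  shows "feasible_region f P V \<noteq> {}"
proof -
  have "continuous_on P (\<lambda>x. Min ((\<lambda>S. wolsey_value f x S) ` A))" if "finite A" "A \<noteq> {}" for A
    using that
  proof (induction A rule: finite_ne_induct)
    case (insert S A)
    then show ?case
      by (auto intro!: continuous_on_min wolsey_value_continuous_on)
  qed (simp add: wolsey_value_continuous_on)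
  then have "continuous_on P (coverage_ext f)"
    unfolding coverage_ext_def[abs_def] wolsey_value_def by simp
  then obtain x where x: "x \<in> P" "\<forall>y\<in>P. coverage_ext f y \<le> coverage_ext f x"
    using continuous_attains_sup[OF P] by blast
  then have "(SUP x\<in>P. coverage_ext f x) \<le> coverage_ext f x"
    using P(2) by (intro cSUP_least) auto
  then show ?thesis using V x(1) by (auto simp: feasible_region_def)
qed

section \<open>Union bound over the steps\<close>

definition result_prob ::
  "('e::finite set \<Rightarrow> real) \<Rightarrow> (real ^ 'e \<Rightarrow> 'e cut option) \<Rightarrow> ('e, 'a) prog \<Rightarrow> ('a \<Rightarrow> bool) \<Rightarrow> real" where
  "result_prob f sep p Q = measure_pmf.prob (run f sep p) {(r, q, s). Q r}"

lemma prob_map_query_counts: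
  "measure_pmf.prob (map_pmf (\<lambda>(a, q, s). (a, g q, g' s)) M) {(r, q, s). Q r}
     = measure_pmf.prob M {(r, q, s). Q r}"
  by (auto intro!: arg_cong[where f = "measure_pmf.prob M"])

lemma prob_bind_pmf:
  "measure_pmf.prob (bind_pmf M N) X = measure_pmf.expectation M (\<lambda>x. measure_pmf.prob (N x) X)"
proof -
  have "ennreal (measure_pmf.prob (bind_pmf M N) X) = (\<integral>\<^sup>+x. ennreal (measure_pmf.prob (N x) X) \<partial>M)"
    by (simp flip: measure_pmf.emeasure_eq_measure)
  also have "\<dots> = ennreal (measure_pmf.expectation M (\<lambda>x. measure_pmf.prob (N x) X))"
    by (intro nn_integral_eq_integral measure_pmf.integrable_const_bound[where B = 1]) auto
  finally show ?thesis by (simp add: integral_nonneg)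
qed

lemma result_prob_sample_cut_Suc:
  fixes x :: "real ^ 'e::finite"
  shows "result_prob f sep (sample_cut \<epsilon> V x on_cut no_cut (Suc m)) Q
    = measure_pmf.expectation (sample_pmf x) (\<lambda>S.
        if wolsey_value f x S < (1 - \<epsilon>) * V then result_prob f sep (on_cut (wolsey_cut f V S)) Q
        else result_prob f sep (sample_cut \<epsilon> V x on_cut no_cut m) Q)"
  unfolding result_prob_def run_sample_cut_Suc
  by (subst prob_bind_pmf)
     (auto simp del: measure_map_pmf simp: prob_map_query_counts[where g' = "\<lambda>s. s"] intro!: Bochner_Integration.integral_cong)

text \<open>Exits through a cut contribute at most \<open>b\<close> in total; the other exit
  requires \<open>m\<close> independent samples without a violation, and contributes at most
  \<open>c\<close> times that probability.\<close>

lemma result_prob_sample_cut_le: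
  fixes x :: "real ^ 'e::finite" and f :: "'e set \<Rightarrow> real" and \<epsilon> V :: real
  defines "p \<equiv> measure_pmf.prob (sample_pmf x) {S. wolsey_value f x S < (1 - \<epsilon>) * V}"
  assumes on_cut: "\<And>c. result_prob f sep (on_cut c) Q \<le> b" and b: "0 \<le> b"
    and no_cut: "result_prob f sep no_cut Q \<le> c"
  shows "result_prob f sep (sample_cut \<epsilon> V x on_cut no_cut m) Q \<le> b + c * (1 - p) ^ m"
proof (induction m)
  case 0
  then show ?case using no_cut b by simp
next
  case (Suc m)
  have c: "0 \<le> c" using no_cut by (rule order_trans[rotated]) (simp add: result_prob_def)
  let ?B = "{S. wolsey_value f x S < (1 - \<epsilon>) * V}"
  \<comment> \<open>A violating sample contributes at most \<open>b\<close>; the induction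
    hypothesis is paid only on the complement, which yields the next factor
    \<open>1 - p\<close>.\<close>
  have "result_prob f sep (sample_cut \<epsilon> V x on_cut no_cut (Suc m)) Q
      \<le> measure_pmf.expectation (sample_pmf x) (\<lambda>S. b + c * (1 - p) ^ m * indicator (- ?B) S)"
    unfolding result_prob_sample_cut_Suc
    using on_cut Suc.IH
    by (intro integral_mono integrable_measure_pmf_finite) auto
  also have "\<dots> = b + c * (1 - p) ^ m * measure_pmf.prob (sample_pmf x) (- ?B)"
    by (subst Bochner_Integration.integral_add) (auto intro: integrable_measure_pmf_finite)
  also have "measure_pmf.prob (sample_pmf x) (- ?B) = 1 - p"
    using measure_pmf.prob_compl[of ?B "sample_pmf x"] by (simp add: p_def Compl_eq_Diff_UNIV)
  finally show ?case by (simp add: mult_ac)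
qed

text \<open>Induction form of the union bound: each step adds at most \<open>\<eta>\<close>, the
  chance that a bad query survives its samples, whatever the history.\<close>

lemma result_prob_steps_le:
  fixes sep :: "real ^ 'e::finite \<Rightarrow> 'e cut option"
  assumes sep: "separation_oracle P sep" and \<eta>: "0 \<le> \<eta>"
    and miss: "\<And>x. x \<in> P \<Longrightarrow> bad x \<Longrightarrow>
      (1 - measure_pmf.prob (sample_pmf x) {S. wolsey_value f x S < (1 - \<epsilon>) * V}) ^ m \<le> \<eta>"
  shows "result_prob f sep (approx_or_separate_steps ALG m \<epsilon> V h k) (\<lambda>r. \<exists>x. r = Some x \<and> bad x)
    \<le> real k * \<eta>"
proof (induction k arbitrary: h)
  case 0
  then show ?case by (simp add: result_prob_def)
next
  case (Suc k)
  let ?Q = "\<lambda>r. \<exists>x. r = Some x \<and> bad x"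
  show ?case
  proof (cases "ALG h")
    case None
    then show ?thesis using \<eta> by (simp add: result_prob_def)
  next
    case (Some x)
    show ?thesis
    proof (cases "sep x")
      case None
      then have xP: "x \<in> P"
        using sep unfolding separation_oracle_def by (metis option.simps(4))
      let ?p = "measure_pmf.prob (sample_pmf x) {S. wolsey_value f x S < (1 - \<epsilon>) * V}"
      have "result_prob f sep (approx_or_separate_steps ALG m \<epsilon> V h (Suc k)) ?Q
          = result_prob f sep (sample_cut \<epsilon> V x
              (\<lambda>c. approx_or_separate_steps ALG m \<epsilon> V (h @ [c]) k) (Return (Some x)) m) ?Q"
        by (simp add: \<open>ALG h = Some x\<close> None result_prob_def prob_map_query_counts[where g = "\<lambda>q. q"]
            del: measure_map_pmf)
      \<comment> \<open>Here \<open>b\<close> comes from the induction hypothesis, and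
        \<open>c\<close> is 0 or 1 because returning \<open>x\<close> directly is bad or not with
        certainty.\<close>
      also have "\<dots> \<le> real k * \<eta> + of_bool (bad x) * (1 - ?p) ^ m"
        by (rule result_prob_sample_cut_le) (use Suc.IH \<eta> in \<open>auto simp: result_prob_def\<close>)
      also have "\<dots> \<le> real (Suc k) * \<eta>"
        using miss[OF xP] \<eta> by (cases "bad x") (auto simp: algebra_simps)
      finally show ?thesis .
    next
      case (Some c)
      have "result_prob f sep (approx_or_separate_steps ALG m \<epsilon> V h (Suc k)) ?Q
          = result_prob f sep (approx_or_separate_steps ALG m \<epsilon> V (h @ [c]) k) ?Q"
        by (simp add: \<open>ALG h = Some x\<close> Some result_prob_def prob_map_query_counts[where g = "\<lambda>q. q"]
            del: measure_map_pmf)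
      also have "\<dots> \<le> real (Suc k) * \<eta>"
        using Suc.IH[of "h @ [c]"] \<eta> by (simp add: algebra_simps)
      finally show ?thesis .
    qed
  qed
qed

text \<open>From \<open>1 - p \<le> exp (- p)\<close> and \<open>m * p \<ge> ln N\<close>; the
  constant 3 in the repetition count cancels the 3 in the bound on \<open>p\<close>.\<close>

lemma one_minus_power_le:
  assumes p: "\<epsilon>\<^sup>2 / 3 \<le> p" "p \<le> 1" and eps: "0 < \<epsilon>" and N: "0 < N"
    and m: "3 * (ln N / \<epsilon>\<^sup>2) \<le> real m"
  shows "(1 - p) ^ m \<le> 1 / N"
proof -
  have "(1 - p) ^ m \<le> exp (- p) ^ m"
    using p exp_ge_add_one_self[of "- p"] by (intro power_mono) auto
  also have "\<dots> = exp (- (real m * p))"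
    by (simp flip: exp_of_nat_mult)
  also have "\<dots> \<le> exp (- ln N)"
  proof -
    have "ln N = \<epsilon>\<^sup>2 / 3 * (3 * (ln N / \<epsilon>\<^sup>2))" using eps by simp
    also have "\<dots> \<le> \<epsilon>\<^sup>2 / 3 * real m" using m by (intro mult_left_mono) auto
    also have "\<dots> \<le> p * real m" using p by (intro mult_right_mono) auto
    finally show ?thesis by (simp add: mult.commute)
  qed
  also have "\<dots> = 1 / N" using N by (simp add: exp_minus inverse_eq_divide)
  finally show ?thesis .
qed


text \<open>The asymptotic repetition count is expressed by bounding \<open>m\<close> between 3 and
  \<open>C\<close> times \<open>ln (T / \<delta>) / \<epsilon>\<^sup>2\<close>: the lower bound
  controls the failure probability, the upper one the value queries. A run with result
  \<open>None\<close> counts as a success in the probability claim.\<close>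

theorem mainTheorem2:
  fixes f :: "'e::finite set \<Rightarrow> real"
    and P :: "(real ^ 'e) set"
    and sep :: "real ^ 'e \<Rightarrow> 'e cut option"
    and ALG :: "'e cp_procedure"
    and T m :: nat
    and \<epsilon> \<delta> V C :: real
  assumes f_nonneg: "\<And>S. f S \<ge> 0"
    and f_mono: "mono f"
    and f_submodular: "submodular f"
    and P_polytope: "polytope P"
    and P_cube: "\<And>x i. x \<in> P \<Longrightarrow> 0 \<le> x $ i \<and> x $ i \<le> 1"
    and sep: "separation_oracle P sep"
    and eps: "0 < \<epsilon>" "\<epsilon> \<le> 1"
    and delta: "0 < \<delta>" "\<delta> \<le> 1"
    and V: "V \<ge> 0"
    and ALG: "cutting_plane_method ALG (feasible_region f P V) T"
    and m_lower: "3 * (ln (real T / \<delta>) / \<epsilon>\<^sup>2) \<le> real m"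
    and m_upper: "real m \<le> C * (ln (real T / \<delta>) / \<epsilon>\<^sup>2)"
  defines "law \<equiv> run f sep (approx_or_separate ALG T m \<epsilon> V)"
  shows "(\<forall>(r, q, s) \<in> set_pmf law. \<forall>x. r = Some x \<longrightarrow> x \<in> P)
       \<and> measure_pmf.prob law
           {(r, q, s). \<forall>x. r = Some x \<longrightarrow>
              multilinear f x \<ge> multilinear f (\<chi> i. 1 - exp (- (x $ i))) \<and>
              multilinear f (\<chi> i. 1 - exp (- (x $ i))) \<ge> (1 - 1 / exp 1 - \<epsilon>) * V} \<ge> 1 - \<delta>
       \<and> (P \<noteq> {} \<and> V \<le> (SUP x\<in>P. coverage_ext f x) \<longrightarrow>
            (\<forall>(r, q, s) \<in> set_pmf law. \<exists>x. r = Some x))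
       \<and> (\<forall>(r, q, s) \<in> set_pmf law.
            real q \<le> 2 * C * (real CARD('e) * real T / \<epsilon>\<^sup>2 * ln (real T / \<delta>)) \<and> s \<le> T)"
proof -
  define bad where "bad x \<longleftrightarrow> \<not> (multilinear f x \<ge> multilinear f (\<chi> i. 1 - exp (- (x $ i))) \<and>
      multilinear f (\<chi> i. 1 - exp (- (x $ i))) \<ge> (1 - 1 / exp 1 - \<epsilon>) * V)" for x
  have law: "law = run f sep (approx_or_separate_steps ALG m \<epsilon> V [] T)"
    by (simp add: law_def approx_or_separate_def)
  have support: "(\<forall>x. r = Some x \<longrightarrow> x \<in> P) \<and> q \<le> T * (m * (CARD('e) + 1)) \<and> s \<le> T"
    if "(r, q, s) \<in> set_pmf law" for r q s
    using set_pmf_run_steps[OF sep] that unfolding law by blast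
  have miss: "(1 - measure_pmf.prob (sample_pmf x) {S. wolsey_value f x S < (1 - \<epsilon>) * V}) ^ m \<le> \<delta> / real T"
    if x: "x \<in> P" and bad: "bad x" and T: "0 < T" for x
  proof -
    have x0: "0 \<le> x $ i" for i using P_cube[OF x] by blast
    \<comment> \<open>On the cube the first inequality always holds, since
      \<open>1 - exp (- u) \<le> u\<close>; so a bad point must violate the second.\<close>
    have "multilinear f (\<chi> i. 1 - exp (- (x $ i))) \<le> multilinear f x"
    proof (rule multilinear_mono[OF f_mono])
      show "(\<chi> i. 1 - exp (- (x $ i))) $ i \<le> x $ i" for i
        using exp_ge_add_one_self[of "- (x $ i)"] by simp
    qed (use P_cube[OF x] in auto)
    then have "multilinear f (\<chi> i. 1 - exp (- (x $ i))) < (1 - 1 / exp 1 - \<epsilon>) * V"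
      using bad by (auto simp: bad_def)
    from violation_probability_lower_bound[OF f_nonneg f_mono x0 eps V this]
    have "(1 - measure_pmf.prob (sample_pmf x) {S. wolsey_value f x S < (1 - \<epsilon>) * V}) ^ m
        \<le> 1 / (real T / \<delta>)"
      by (rule one_minus_power_le) (use eps delta T m_lower in auto)
    then show ?thesis by simp
  qed
  have "measure_pmf.prob law {(r, q, s). \<exists>x. r = Some x \<and> bad x} \<le> \<delta>"
  \<comment> \<open>Without steps the result is \<open>None\<close> with certainty, so no bad point
    is returned; otherwise the per-step failure bound is \<delta>/T.\<close>
  proof (cases "T = 0")
    case True
    then show ?thesis using delta by (simp add: law)
  next
    case False
    have "measure_pmf.prob law {(r, q, s). \<exists>x. r = Some x \<and> bad x} \<le> real T * (\<delta> / real T)"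
      unfolding law
      by (rule result_prob_steps_le[OF sep, unfolded result_prob_def]) (use miss delta False in auto)
    then show ?thesis using False by simp
  qed
  moreover have "{(r, q, s). \<forall>x. r = Some x \<longrightarrow>
              multilinear f x \<ge> multilinear f (\<chi> i. 1 - exp (- (x $ i))) \<and>
              multilinear f (\<chi> i. 1 - exp (- (x $ i))) \<ge> (1 - 1 / exp 1 - \<epsilon>) * V}
      = space (measure_pmf law) - {(r, q, s). \<exists>x. r = Some x \<and> bad x}"
    by (auto simp: bad_def)
  ultimately have prob: "measure_pmf.prob law {(r, q, s). \<forall>x. r = Some x \<longrightarrow>
              multilinear f x \<ge> multilinear f (\<chi> i. 1 - exp (- (x $ i))) \<and>
              multilinear f (\<chi> i. 1 - exp (- (x $ i))) \<ge> (1 - 1 / exp 1 - \<epsilon>) * V} \<ge> 1 - \<delta>"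
    by (simp only: measure_pmf.prob_compl sets_measure_pmf UNIV_I)
  have returns_point: "\<exists>x. r = Some x"
    if "P \<noteq> {}" "V \<le> (SUP x\<in>P. coverage_ext f x)" and "(r, q, s) \<in> set_pmf law" for r q s
    using feasible_region_nonempty[OF polytope_imp_compact[OF P_polytope] that(1,2)] that(3) eps V
    by (intro set_pmf_run_steps_Some[OF sep _ _ ALG, where h = "[]" and k = T])
       (auto simp: law intro: proper_history.intros)
  have queries: "real q \<le> 2 * C * (real CARD('e) * real T / \<epsilon>\<^sup>2 * ln (real T / \<delta>))"
    if "(r, q, s) \<in> set_pmf law" for r q s
  proof -
    \<comment> \<open>The ground set is a nonempty type, so \<open>n + 1 \<le> 2 * n\<close>; this
      is the factor 2 in the query bound.\<close>
    have "CARD('e) + 1 \<le> 2 * CARD('e)" by (simp add: Suc_leI)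
    then have "q \<le> T * (m * (2 * CARD('e)))"
      using support[OF that] by (meson mult_le_mono2 order_trans)
    then have "real q \<le> real (T * (m * (2 * CARD('e))))" by (rule of_nat_mono)
    also have "\<dots> = 2 * real T * real CARD('e) * real m" by simp
    also have "\<dots> \<le> 2 * real T * real CARD('e) * (C * (ln (real T / \<delta>) / \<epsilon>\<^sup>2))"
      using m_upper by (intro mult_left_mono) auto
    finally show ?thesis by (simp add: mult_ac)
  qed
  show ?thesis
    using prob support returns_point queries by blast
qed

end
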